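(* The set of valid formulas of the language $\mathcal L_{\mathrm{DL\text{-}S}^*}(\mathit{Atm},\mathit{Agt})$ (the full dynamic logic of space, with sequential composition, nondeterministic choice, iteration and test) is not computably enumerable.
   Context: $\mathit{Atm}$ is a countably infinite set of atomic propositions and $\mathit{Agt}=\{1,\dots,n\}$ is a finite set of agents. Spatial programs $\alpha$ and formulas $\varphi$ of $\mathcal L_{\mathrm{DL\text{-}S}^*}(\mathit{Atm},\mathit{Agt})$ are defined by mutual recursion: $\alpha ::= \Uparrow \mid \Downarrow \mid \Rightarrow \mid \Leftarrow \mid \alpha;\alpha' \mid \alpha\cup\alpha' \mid \alpha^* \mid ?\varphi$, and $\varphi ::= p \mid \mathsf h_i \mid \neg\varphi \mid \varphi\wedge\psi \mid [\alpha]\varphi$, with $p\in \mathit{Atm}$, $i\in \mathit{Agt}$. A spatial model is a pair $M=(\mathcal P,\mathcal V)$ with $\mathcal P:\mathit{Agt}\to\mathbb Z\times\mathbb Z$ and $\mathcal V:\mathbb Z\times\mathbb Z\to 2^{\mathit{Atm}}$. Binary relations $R_\alpha$ on $\mathbb Z\times\mathbb Z$ and truth are defined by parallel induction: $(x,y)R_\Uparrow(x,y+1)$, $(x,y)R_\Downarrow(x,y-1)$, $(x,y)R_\Rightarrow(x+1,y)$, $(x,y)R_\Leftarrow(x-1,y)$ (and no other pairs); $R_{\alpha_1;\alpha_2}=R_{\alpha_1}\circ R_{\alpha_2}$ (first $R_{\alpha_1}$, then $R_{\alpha_2}$); $R_{\alpha_1\cup\alpha_2}=R_{\alpha_1}\cup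 R_{\alpha_2}$; $R_{\alpha^*}$ is the reflexive transitive closure of $R_\alpha$; $R_{?\varphi}=\{((x,y),(x,y)): M,(x,y)\models\varphi\}$. Truth: $M,(x,y)\models p$ iff $p\in\mathcal V(x,y)$; $M,(x,y)\models \mathsf h_i$ iff $\mathcal P(i)=(x,y)$; Boolean connectives as usual; $M,(x,y)\models[\alpha]\varphi$ iff $M,(x',y')\models\varphi$ for all $(x',y')$ with $(x,y)R_\alpha(x',y')$. A formula is valid if it is true in every spatial model at every position. *)

theory Defs
  imports Main "HOL-Library.Cardinality" "HOL-Library.Nat_Bijection"
begin

section \<open>The dynamic logic of space\<close>

text \<open>The type variable \<open>'p\<close> stands for the set of atomic propositions, \<open>'i\<close> for the set of agents.\<close>

datatype ('p, 'i) prog =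
    Up
  | Down
  | Rgt
  | Lft
  | Seq "('p, 'i) prog" "('p, 'i) prog"
  | Choice "('p, 'i) prog" "('p, 'i) prog"
  | Iter "('p, 'i) prog"
  | Test "('p, 'i) fm"
and ('p, 'i) fm =
    Atom 'p
  | Here 'i
  | Neg "('p, 'i) fm"
  | Conj "('p, 'i) fm" "('p, 'i) fm"
  | Box "('p, 'i) prog" "('p, 'i) fm"

type_synonym pos = "int \<times> int"

type_synonym ('p, 'i) spatial_model = "('i \<Rightarrow> pos) \<times> (pos \<Rightarrow> 'p set)"

primrec rel :: "('p, 'i) spatial_model \<Rightarrow> ('p, 'i) prog \<Rightarrow> (pos \<times> pos) set"
  and sat :: "('p, 'i) spatial_model \<Rightarrow> ('p, 'i) fm \<Rightarrow> pos \<Rightarrow> bool"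
where
  "rel M Up = {((x, y), (x, y + 1)) | x y. True}"
| "rel M Down = {((x, y), (x, y - 1)) | x y. True}"
| "rel M Rgt = {((x, y), (x + 1, y)) | x y. True}"
| "rel M Lft = {((x, y), (x - 1, y)) | x y. True}"
| "rel M (Seq a b) = rel M a O rel M b"
| "rel M (Choice a b) = rel M a \<union> rel M b"
| "rel M (Iter a) = (rel M a)\<^sup>*"
| "rel M (Test \<phi>) = {(s, s) | s. sat M \<phi> s}"
| "sat M (Atom p) s \<longleftrightarrow> p \<in> snd M s"
| "sat M (Here i) s \<longleftrightarrow> fst M i = s"
| "sat M (Neg \<phi>) s \<longleftrightarrow> \<not> sat M \<phi> s"
| "sat M (Conj \<phi> \<psi>) s \<longleftrightarrow> sat M \<phi> s \<and> sat M \<psi> s"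
| "sat M (Box a \<phi>) s \<longleftrightarrow> (\<forall>s'. (s, s') \<in> rel M a \<longrightarrow> sat M \<phi> s')"

definition valid :: "('p, 'i) fm \<Rightarrow> bool" where
  "valid \<phi> \<longleftrightarrow> (\<forall>M s. sat M \<phi> s)"


section \<open>Goedel numbering of formulas\<close>

text \<open>The numbering is relative to a numbering \<open>a\<close> of the atomic propositions and a numbering \<open>g\<close> of
  the agents. Programs and formulas are numbered separately.\<close>

primrec prog_code :: "('p \<Rightarrow> nat) \<Rightarrow> ('i \<Rightarrow> nat) \<Rightarrow> ('p, 'i) prog \<Rightarrow> nat"
  and fm_code :: "('p \<Rightarrow> nat) \<Rightarrow> ('i \<Rightarrow> nat) \<Rightarrow> ('p, 'i) fm \<Rightarrow> nat"
where
  "prog_code a g Up = prod_encode (0, 0)"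
| "prog_code a g Down = prod_encode (1, 0)"
| "prog_code a g Rgt = prod_encode (2, 0)"
| "prog_code a g Lft = prod_encode (3, 0)"
| "prog_code a g (Seq \<alpha> \<beta>) = prod_encode (4, prod_encode (prog_code a g \<alpha>, prog_code a g \<beta>))"
| "prog_code a g (Choice \<alpha> \<beta>) = prod_encode (5, prod_encode (prog_code a g \<alpha>, prog_code a g \<beta>))"
| "prog_code a g (Iter \<alpha>) = prod_encode (6, prog_code a g \<alpha>)"
| "prog_code a g (Test \<phi>) = prod_encode (7, fm_code a g \<phi>)"
| "fm_code a g (Atom p) = prod_encode (0, a p)"
| "fm_code a g (Here i) = prod_encode (1, g i)"
| "fm_code a g (Neg \<phi>) = prod_encode (2, fm_code a g \<phi>)"
| "fm_code a g (Conj \<phi> \<psi>) = prod_encode (3, prod_encode (fm_code a g \<phi>, fm_code a g \<psi>))"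
| "fm_code a g (Box \<alpha> \<phi>) = prod_encode (4, prod_encode (prog_code a g \<alpha>, fm_code a g \<phi>))"

lemma code_inject:
  fixes \<alpha> :: "('p, 'i) prog" and \<phi> :: "('p, 'i) fm"
  assumes "inj a" and "inj g"
  shows "prog_code a g \<alpha> = prog_code a g \<beta> \<Longrightarrow> \<alpha> = \<beta>"
    and "fm_code a g \<phi> = fm_code a g \<psi> \<Longrightarrow> \<phi> = \<psi>"
proof (induction \<alpha> and \<phi> arbitrary: \<beta> and \<psi>)
  case Up then show ?case by (cases \<beta>) (auto simp: prod_encode_eq)
next
  case Down then show ?case by (cases \<beta>) (auto simp: prod_encode_eq)
next
  case Rgt then show ?case by (cases \<beta>) (auto simp: prod_encode_eq)
next
  case Lft then show ?case by (cases \<beta>) (auto simp: prod_encode_eq)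
next
  case (Seq x1 x2) then show ?case by (cases \<beta>) (auto simp: prod_encode_eq)
next
  case (Choice x1 x2) then show ?case by (cases \<beta>) (auto simp: prod_encode_eq)
next
  case (Iter x) then show ?case by (cases \<beta>) (auto simp: prod_encode_eq)
next
  case (Test x) then show ?case by (cases \<beta>) (auto simp: prod_encode_eq)
next
  case (Atom x) then show ?case
    using assms by (cases \<psi>) (auto simp: prod_encode_eq dest: injD)
next
  case (Here x) then show ?case
    using assms by (cases \<psi>) (auto simp: prod_encode_eq dest: injD)
next
  case (Neg x) then show ?case by (cases \<psi>) (auto simp: prod_encode_eq)
next
  case (Conj x1 x2) then show ?case by (cases \<psi>) (auto simp: prod_encode_eq)
next
  case (Box x1 x2) then show ?case by (cases \<psi>) (auto simp: prod_encode_eq)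
qed

lemma inj_fm_code: "inj a \<Longrightarrow> inj g \<Longrightarrow> inj (fm_code a g)"
  by (meson code_inject(2) injI)


section \<open>Computably enumerable sets\<close>

text \<open>Kleene's partial recursive functions. Arities are not fixed by the syntax; \<open>Zero\<close>
  stands for the constant zero functions of all arities, and \<open>Proj i\<close> (counting from 0) for the
  projections of all arities above \<open>i\<close>. In \<open>PrimRec\<close> and \<open>Mu\<close> the recursion and search variable is
  the first argument.\<close>

datatype recf =
    Zero
  | Succ
  | Proj nat
  | Comp recf "recf list"
  | PrimRec recf recf
  | Mu recf

text \<open>\<open>eval f xs y\<close>: the function denoted by \<open>f\<close> is defined at \<open>xs\<close>, with value \<open>y\<close>.\<close>

inductive eval :: "recf \<Rightarrow> nat list \<Rightarrow> nat \<Rightarrow> bool" where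
  eval_Zero: "eval Zero xs 0"
| eval_Succ: "eval Succ [x] (Suc x)"
| eval_Proj: "i < length xs \<Longrightarrow> eval (Proj i) xs (xs ! i)"
| eval_Comp: "list_all2 (\<lambda>g y. eval g xs y) gs ys \<Longrightarrow> eval f ys z \<Longrightarrow> eval (Comp f gs) xs z"
| eval_PrimRec_0: "eval f xs y \<Longrightarrow> eval (PrimRec f g) (0 # xs) y"
| eval_PrimRec_Suc: "eval (PrimRec f g) (n # xs) y \<Longrightarrow> eval g (n # y # xs) z
    \<Longrightarrow> eval (PrimRec f g) (Suc n # xs) z"
| eval_Mu: "eval f (n # xs) 0 \<Longrightarrow> (\<forall>m < n. \<exists>k. eval f (m # xs) (Suc k)) \<Longrightarrow> eval (Mu f) xs n"

inductive_cases eval_ZeroE: "eval Zero xs y"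
inductive_cases eval_SuccE: "eval Succ xs y"
inductive_cases eval_ProjE: "eval (Proj i) xs y"
inductive_cases eval_CompE: "eval (Comp f gs) xs y"
inductive_cases eval_PrimRec_0E: "eval (PrimRec f g) (0 # xs) y"
inductive_cases eval_PrimRec_SucE: "eval (PrimRec f g) (Suc n # xs) y"
inductive_cases eval_MuE: "eval (Mu f) xs y"

lemma eval_unique: "eval f xs y \<Longrightarrow> eval f xs z \<Longrightarrow> y = z"
proof (induction arbitrary: z rule: eval.induct)
  case (eval_Zero xs)
  then show ?case by (rule eval_ZeroE) simp
next
  case (eval_Succ x)
  then show ?case by (rule eval_SuccE) simp
next
  case (eval_Proj i xs)
  from eval_Proj.prems show ?case by (rule eval_ProjE) simp
next
  case (eval_Comp xs gs ys f w)
  from eval_Comp.prems obtain ys' where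
    ys': "list_all2 (\<lambda>g y. eval g xs y) gs ys'" and z: "eval f ys' z"
    by (rule eval_CompE)
  have "ys = ys'"
    using eval_Comp.IH(1) ys' by (auto simp: list_all2_conv_all_nth intro!: nth_equalityI)
  with eval_Comp.IH(2) z show ?case by blast
next
  case (eval_PrimRec_0 f xs y g)
  from eval_PrimRec_0.prems have "eval f xs z" by (rule eval_PrimRec_0E)
  then show ?case by (rule eval_PrimRec_0.IH)
next
  case (eval_PrimRec_Suc f g n xs y w)
  from eval_PrimRec_Suc.prems obtain y' where
    "eval (PrimRec f g) (n # xs) y'" and z: "eval g (n # y' # xs) z"
    by (rule eval_PrimRec_SucE)
  then have "y = y'" by (intro eval_PrimRec_Suc.IH(1))
  with z show ?case by (intro eval_PrimRec_Suc.IH(2)) simp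
next
  case (eval_Mu f n xs)
  from eval_Mu.prems have z: "eval f (z # xs) 0" "\<forall>m < z. \<exists>k. eval f (m # xs) (Suc k)"
    by (auto elim: eval_MuE)
  have "\<not> n < z"
    using eval_Mu.IH(1) z(2) by blast
  moreover have "\<not> z < n"
    using eval_Mu.IH(2) z(1) by blast
  ultimately show ?case by simp
qed

text \<open>A set of natural numbers is computably enumerable iff it is the domain of a unary partial
  recursive function.\<close>

definition computably_enumerable :: "nat set \<Rightarrow> bool" where
  "computably_enumerable A \<longleftrightarrow> (\<exists>f. A = {x. \<exists>y. eval f [x] y})"

end

theory Submission
  imports Defs "HOL-Computational_Algebra.Primes" "HOL-Library.Infinite_Set"
begin

text \<open>Relative to the position of a fixed agent, a point of the grid is a pair of counters. Programs
  can increment and decrement them, and can test them for zero, since formulas can say that the agent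
  is in the current column or row. So spatial programs simulate two-counter machines, and, with
  registers stored as prime exponents of the first counter, all partial recursive functions:
  for every such \<open>f\<close> there is a formula \<open>\<chi>\<close> that says, at the point encoding \<open>n\<close>, that \<open>f\<close> is
  undefined at \<open>n\<close>. The formula \<open>\<psi> \<chi> n\<close> saying that \<open>\<chi>\<close> holds at the point encoding \<open>n\<close>,
  provided that the agent is here, is then valid iff \<open>f\<close> is undefined at \<open>n\<close>.

  The diagonal argument needs no universal machine. The function \<open>d\<close> taking the code \<open>m\<close> of any
  \<open>\<chi>\<close> to the code of \<open>\<psi> \<chi> m\<close> is primitive recursive. If the valid formulas were the domain of
  \<open>e\<close>, take \<open>\<chi>\<close> for \<open>f = e \<circ> d\<close>, and let \<open>m\<close> be its code: then \<open>\<psi> \<chi> m\<close> is valid iff \<open>e\<close> is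
  undefined at its code, that is, iff it is not valid.\<close>

section \<open>Arithmetic on the grid\<close>

text \<open>The continuation \<open>b\<close> serves as the base case, so no separate skip program
  is needed, and repetitions of different steps can be chained.\<close>

primrec repeat :: "('p, 'i) prog \<Rightarrow> nat \<Rightarrow> ('p, 'i) prog \<Rightarrow> ('p, 'i) prog" where
  "repeat a 0 b = b"
| "repeat a (Suc n) b = Seq a (repeat a n b)"

lemma rel_repeat: "rel M (repeat a n b) = rel M a ^^ n O rel M b"
  by (induction n) (simp_all add: relpow_commute O_assoc[symmetric])

definition translation :: "int \<Rightarrow> int \<Rightarrow> (pos \<times> pos) set" where
  "translation u v = {((x, y), (x + u, y + v)) |x y. True}"

lemma rtrancl_translation:
  "(((x, y), s) \<in> (translation u v)\<^sup>*) \<longleftrightarrow>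
    (\<exists>n. s = (x + int n * u, y + int n * v))" (is "?L \<longleftrightarrow> ?R")
proof
  show "?L \<Longrightarrow> ?R"
  proof (induction rule: rtrancl_induct)
    case base
    show ?case by (rule exI[of _ 0]) simp
  next
    case (step s t)
    then obtain n where "s = (x + int n * u, y + int n * v)" "t = (fst s + u, snd s + v)"
      by (auto simp: translation_def)
    then show ?case by (intro exI[of _ "Suc n"]) (simp add: algebra_simps)
  qed
  have "((x, y), (x + int n * u, y + int n * v)) \<in> (translation u v)\<^sup>*" for n
  proof (induction n)
    case (Suc n)
    then show ?case
      by (rule rtrancl_into_rtrancl) (simp add: translation_def algebra_simps)
  qed simp
  then show "?R \<Longrightarrow> ?L" by auto
qed

lemma relpow_translation:
  "translation u v ^^ n
    = translation (int n * u) (int n * v)"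
  by (induction n) (auto simp: translation_def relcomp_unfold algebra_simps)

text \<open>Falsity is built from the agent, so that no atomic proposition is needed.\<close>

definition Bot :: "'i \<Rightarrow> ('p, 'i) fm" where
  "Bot h = Conj (Here h) (Neg (Here h))"

text \<open>The negated box is a diamond: some number of purely vertical moves leads to the
  agent.\<close>

definition same_column :: "'i \<Rightarrow> ('p, 'i) fm" where
  "same_column h = Neg (Box (Choice (Iter Up) (Iter Down)) (Neg (Here h)))"

definition same_row :: "'i \<Rightarrow> ('p, 'i) fm" where
  "same_row h = Neg (Box (Choice (Iter Rgt) (Iter Lft)) (Neg (Here h)))"

text \<open>A run that takes a counter below zero cannot pass the test for zero afterwards, so no sign checks
  are needed, and there is no run at all if \<open>c\<close> does not divide the first counter.\<close>

definition transfer :: "'i \<Rightarrow> nat \<Rightarrow> nat \<Rightarrow> ('p, 'i) prog" where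
  "transfer h c d =
    Seq (Iter (repeat Lft c (repeat Up d (Test (Neg (Bot h))))))
      (Seq (Test (same_column h)) (Seq (Iter (Seq Down Rgt)) (Test (same_row h))))"

lemma sat_Bot [simp]: "\<not> sat M (Bot h) s"
  by (simp add: Bot_def)

lemma rel_steps:
  "rel M Up = translation 0 1"
  "rel M Down = translation 0 (-1)"
  "rel M Rgt = translation 1 0"
  "rel M Lft = translation (-1) 0"
  by (auto simp: translation_def)

lemma int_eq_offset: "\<exists>n. b = y + int n \<or> b = y - int n"
proof (cases "y \<le> b")
  case True
  then show ?thesis by (intro exI[of _ "nat (b - y)"]) simp
next
  case False
  then show ?thesis by (intro exI[of _ "nat (y - b)"]) simp
qed

lemma sat_same_column:
  assumes "fst M h = (a, b)"
  shows "sat M (same_column h) (x, y) \<longleftrightarrow> x = a"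
  using int_eq_offset[of b y] assms
  by (auto simp: same_column_def rel_steps rtrancl_translation
      simp del: rel.simps(1-4) split_paired_Ex split_paired_All)

lemma sat_same_row:
  assumes "fst M h = (a, b)"
  shows "sat M (same_row h) (x, y) \<longleftrightarrow> y = b"
  using int_eq_offset[of a x] assms
  by (auto simp: same_row_def rel_steps rtrancl_translation
      simp del: rel.simps(1-4) split_paired_Ex split_paired_All)

text \<open>The first loop trades \<open>c\<close> columns for \<open>d\<close> rows until the
  agent's column is reached, which needs \<open>N\<close> to be a multiple of \<open>c\<close>. The
  second loop turns the height back into width. The effect on the first counter is division by
  \<open>c\<close> and multiplication by \<open>d\<close>.\<close>

lemma rel_transfer:
  assumes "fst M h = (a, b)"
  shows "((a + int N, b), s) \<in> rel M (transfer h c d) \<longleftrightarrow>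
    (\<exists>n. N = c * n \<and> s = (a + int (d * n), b))"
proof -
  \<comment> \<open>Each loop body is a single translation, so its iterates have a closed
    form.\<close>
  have 1: "rel M (repeat Lft c (repeat Up d (Test (Neg (Bot h)))))
      = translation (- int c) (int d)"
    unfolding rel_repeat rel_steps relpow_translation by (auto simp: translation_def relcomp_unfold)
  have 2: "rel M (Seq Down Rgt) = translation 1 (- 1)"
    by (auto simp: translation_def relcomp_unfold)
  \<comment> \<open>Here \<open>n\<close> counts the rounds of the first loop and \<open>m\<close>
    those of the second; each equation comes from the test after the loop.\<close>
  have "((a + int N, b), s) \<in> rel M (transfer h c d) \<longleftrightarrow>
    (\<exists>n. int N = int n * int c \<and> (\<exists>m. int m = int n * int d \<and> s = (a + int m, b)))"
    unfolding transfer_def rel.simps(5,7,8) 1 2[unfolded rel.simps(5)]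
    by (auto simp: relcomp_unfold rtrancl_translation sat_same_column[OF assms]
        sat_same_row[OF assms]) (metis add_diff_cancel_right')
  also have "\<dots> \<longleftrightarrow> (\<exists>n. N = c * n \<and> s = (a + int (d * n), b))"
    by (metis (no_types, opaque_lifting) mult.commute of_nat_eq_iff of_nat_mult)
  finally show ?thesis .
qed

section \<open>Register machines\<close>

type_synonym state = "nat \<Rightarrow> nat"

definition pr :: "nat \<Rightarrow> nat" where
  "pr = enumerate {p. prime p}"

lemma prime_pr [simp]: "prime (pr i)"
  unfolding pr_def using enumerate_in_set[OF primes_infinite, of i] by simp

lemma pr_inject [simp]: "pr i = pr j \<longleftrightarrow> i = j"
  unfolding pr_def using inj_enumerate[OF primes_infinite] by (auto dest: injD)

text \<open>The state is the exponent vector of \<open>N\<close>, hence zero almost everywhere. Zero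
  must be excluded as a value of \<open>N\<close>: it would look like the state with all registers
  empty, and multiplication would not change it.\<close>

definition represents :: "pos \<Rightarrow> pos \<Rightarrow> state \<Rightarrow> bool" where
  "represents r s \<sigma> \<longleftrightarrow>
    (\<exists>N>0. s = (fst r + int N, snd r) \<and> \<sigma> = (\<lambda>i. multiplicity (pr i) N))"

text \<open>This is a forth and back condition, uniform in the model. It restricts runs only from
  points that represent a state, and such runs must end at points of the same kind.\<close>

definition realizes :: "'i \<Rightarrow> ('p, 'i) prog \<Rightarrow> (state \<times> state) set \<Rightarrow> bool" where
  "realizes h \<alpha> T \<longleftrightarrow> (\<forall>M s \<sigma>. represents (fst M h) s \<sigma> \<longrightarrow>
    (\<forall>s'. (s, s') \<in> rel M \<alpha> \<longrightarrow> (\<exists>\<sigma>'. (\<sigma>, \<sigma>') \<in> T \<and> represents (fst M h) s' \<sigma>')) \<and>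
    (\<forall>\<sigma>'. (\<sigma>, \<sigma>') \<in> T \<longrightarrow> (\<exists>s'. (s, s') \<in> rel M \<alpha> \<and> represents (fst M h) s' \<sigma>')))"

lemma realizes_forth:
  "realizes h \<alpha> T \<Longrightarrow> represents (fst M h) s \<sigma> \<Longrightarrow> (s, s') \<in> rel M \<alpha>
    \<Longrightarrow> \<exists>\<sigma>'. (\<sigma>, \<sigma>') \<in> T \<and> represents (fst M h) s' \<sigma>'"
  unfolding realizes_def by blast

lemma realizes_back:
  "realizes h \<alpha> T \<Longrightarrow> represents (fst M h) s \<sigma> \<Longrightarrow> (\<sigma>, \<sigma>') \<in> T
    \<Longrightarrow> \<exists>s'. (s, s') \<in> rel M \<alpha> \<and> represents (fst M h) s' \<sigma>'"
  unfolding realizes_def by blast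

text \<open>Truth that depends only on the represented state is preserved by boxes: the forth
  condition gives one direction and the back condition the other.\<close>

lemma sat_Box_realizes:
  assumes "realizes h \<alpha> T" and "represents (fst M h) s \<sigma>"
    and "\<And>s' \<sigma>'. represents (fst M h) s' \<sigma>' \<Longrightarrow> sat M \<chi> s' \<longleftrightarrow> Q \<sigma>'"
  shows "sat M (Box \<alpha> \<chi>) s \<longleftrightarrow> (\<forall>\<sigma>'. (\<sigma>, \<sigma>') \<in> T \<longrightarrow> Q \<sigma>')"
  using realizes_forth[OF assms(1,2)] realizes_back[OF assms(1,2)] assms(3) by (auto; metis)

lemma realizes_Seq:
  assumes "realizes h \<alpha> T" and "realizes h \<beta> U"
  shows "realizes h (Seq \<alpha> \<beta>) (T O U)"
  unfolding realizes_def
proof (intro allI impI conjI)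
  fix M :: "('b, 'a) spatial_model" and s \<sigma> assume r: "represents (fst M h) s \<sigma>"
  show "\<exists>\<sigma>'. (\<sigma>, \<sigma>') \<in> T O U \<and> represents (fst M h) s' \<sigma>'" if "(s, s') \<in> rel M (Seq \<alpha> \<beta>)" for s'
  proof -
    from that obtain t where t: "(s, t) \<in> rel M \<alpha>" "(t, s') \<in> rel M \<beta>" by auto
    obtain \<tau> where "(\<sigma>, \<tau>) \<in> T" "represents (fst M h) t \<tau>"
      using realizes_forth[OF assms(1) r t(1)] by blast
    with realizes_forth[OF assms(2) _ t(2)] show ?thesis by blast
  qed
  show "\<exists>s'. (s, s') \<in> rel M (Seq \<alpha> \<beta>) \<and> represents (fst M h) s' \<sigma>'" if "(\<sigma>, \<sigma>') \<in> T O U" for \<sigma>'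
  proof -
    from that obtain \<tau> where \<tau>: "(\<sigma>, \<tau>) \<in> T" "(\<tau>, \<sigma>') \<in> U" by auto
    obtain t where "(s, t) \<in> rel M \<alpha>" "represents (fst M h) t \<tau>"
      using realizes_back[OF assms(1) r \<tau>(1)] by blast
    with realizes_back[OF assms(2) _ \<tau>(2)] show ?thesis unfolding rel.simps by blast
  qed
qed

text \<open>Both directions go by induction along a run: each step ends at a point that represents a
  state, so the hypothesis on single steps applies again.\<close>

lemma realizes_Iter:
  assumes "realizes h \<alpha> T"
  shows "realizes h (Iter \<alpha>) (T\<^sup>*)"
  unfolding realizes_def
proof (intro allI impI conjI)
  fix M :: "('b, 'a) spatial_model" and s \<sigma> assume r: "represents (fst M h) s \<sigma>"
  show "\<exists>\<sigma>'. (\<sigma>, \<sigma>') \<in> T\<^sup>* \<and> represents (fst M h) s' \<sigma>'" if "(s, s') \<in> rel M (Iter \<alpha>)" for s'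
    using that[unfolded rel.simps]
  proof (induction rule: rtrancl_induct)
    case base
    then show ?case using r by blast
  next
    case (step t u)
    then show ?case using realizes_forth[OF assms] by (meson rtrancl.rtrancl_into_rtrancl)
  qed
  show "\<exists>s'. (s, s') \<in> rel M (Iter \<alpha>) \<and> represents (fst M h) s' \<sigma>'" if "(\<sigma>, \<sigma>') \<in> T\<^sup>*" for \<sigma>'
    using that unfolding rel.simps
  proof (induction rule: rtrancl_induct)
    case base
    then show ?case using r by blast
  next
    case (step t u)
    then show ?case using realizes_back[OF assms] by (meson rtrancl.rtrancl_into_rtrancl)
  qed
qed

section \<open>Increment, decrement and zero test\<close>

definition inc :: "nat \<Rightarrow> (state \<times> state) set" where
  "inc i = {(\<sigma>, \<sigma>') . \<sigma>' = \<sigma>(i := Suc (\<sigma> i))}"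

definition dec :: "nat \<Rightarrow> (state \<times> state) set" where
  "dec i = {(\<sigma>, \<sigma>') . \<exists>n. \<sigma> i = Suc n \<and> \<sigma>' = \<sigma>(i := n)}"

definition is_zero :: "nat \<Rightarrow> (state \<times> state) set" where
  "is_zero i = {(\<sigma>, \<sigma>') . \<sigma> i = 0 \<and> \<sigma>' = \<sigma>}"

lemma multiplicity_pr_times:
  assumes "N > 0"
  shows "(\<lambda>j. multiplicity (pr j) (pr i * N)) =
    (\<lambda>j. multiplicity (pr j) N)(i := Suc (multiplicity (pr i) N))"
proof
  fix j
  have "pr i \<noteq> 0" "\<not> is_unit (pr i)"
    using prime_gt_1_nat[OF prime_pr, of i] by auto
  then show "multiplicity (pr j) (pr i * N) =
    ((\<lambda>j. multiplicity (pr j) N)(i := Suc (multiplicity (pr i) N))) j"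
    using assms
    by (simp add: multiplicity_times_same prime_elem_multiplicity_mult_distrib
        prime_multiplicity_other)
qed

text \<open>Division by 1 always succeeds, so the program multiplies \<open>N\<close> by
  \<open>pr i\<close>, which raises one exponent by one.\<close>

lemma realizes_inc: "realizes h (transfer h 1 (pr i)) (inc i)"
  unfolding realizes_def
proof (intro allI impI)
  fix M :: "('b, 'a) spatial_model" and s \<sigma> assume "represents (fst M h) s \<sigma>"
  moreover obtain a b where ab: "fst M h = (a, b)" by fastforce
  ultimately obtain N where N: "N > 0" "s = (a + int N, b)" "\<sigma> = (\<lambda>i. multiplicity (pr i) N)"
    by (auto simp: represents_def)
  have "represents (a, b) (a + int (pr i * N), b) (\<sigma>(i := Suc (\<sigma> i)))"
    unfolding represents_def N(3) multiplicity_pr_times[OF N(1), symmetric]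
    using N(1) by (intro exI[of _ "pr i * N"]) (simp add: prime_gt_0_nat)
  then show "(\<forall>s'. (s, s') \<in> rel M (transfer h 1 (pr i)) \<longrightarrow>
            (\<exists>\<sigma>'. (\<sigma>, \<sigma>') \<in> inc i \<and> represents (fst M h) s' \<sigma>')) \<and>
       (\<forall>\<sigma>'. (\<sigma>, \<sigma>') \<in> inc i \<longrightarrow>
            (\<exists>s'. (s, s') \<in> rel M (transfer h 1 (pr i)) \<and> represents (fst M h) s' \<sigma>'))"
    unfolding N(2) rel_transfer[OF ab] inc_def ab by simp
qed

text \<open>The program divides \<open>N\<close> by \<open>pr i\<close>. It has no run when the
  division is not exact, that is, when register \<open>i\<close> is empty, and there
  \<open>dec i\<close> has no successor either.\<close>

lemma realizes_dec: "realizes h (transfer h (pr i) 1) (dec i)"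
  unfolding realizes_def
proof (intro allI impI)
  fix M :: "('b, 'a) spatial_model" and s \<sigma> assume "represents (fst M h) s \<sigma>"
  moreover obtain a b where ab: "fst M h = (a, b)" by fastforce
  ultimately obtain N where N: "N > 0" "s = (a + int N, b)" "\<sigma> = (\<lambda>i. multiplicity (pr i) N)"
    by (auto simp: represents_def)
  have 1: "represents (a, b) (a + int n, b) \<tau> \<and> (\<sigma>, \<tau>) \<in> dec i"
    if "N = pr i * n" "\<tau> = (\<lambda>i. multiplicity (pr i) n)" for n \<tau>
  proof -
    have n: "n > 0" using that N(1) by (cases n) auto
    then have "represents (a, b) (a + int n, b) \<tau>"
      unfolding represents_def that by auto
    then show ?thesis
      unfolding N(3) that(1) multiplicity_pr_times[OF n] dec_def that(2) by (simp add: fun_eq_iff)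
  qed
  have 2: "\<exists>n. N = pr i * n \<and> \<tau> = (\<lambda>i. multiplicity (pr i) n)" if "(\<sigma>, \<tau>) \<in> dec i" for \<tau>
  proof -
    have "multiplicity (pr i) N \<noteq> 0" using that N(3) by (auto simp: dec_def)
    then have "pr i dvd N" using not_dvd_imp_multiplicity_0[of "pr i" N] by auto
    then obtain n where n: "N = pr i * n" by (elim dvdE)
    \<comment> \<open>Since \<open>dec i\<close> is single-valued, the given successor must be the
      state of the quotient.\<close>
    have "(\<sigma>, \<lambda>i. multiplicity (pr i) n) \<in> dec i" using 1[OF n refl] by simp
    with that have "\<tau> = (\<lambda>i. multiplicity (pr i) n)" by (auto simp: dec_def)
    with n show ?thesis by auto
  qed
  show "(\<forall>s'. (s, s') \<in> rel M (transfer h (pr i) 1) \<longrightarrow>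
            (\<exists>\<sigma>'. (\<sigma>, \<sigma>') \<in> dec i \<and> represents (fst M h) s' \<sigma>')) \<and>
       (\<forall>\<sigma>'. (\<sigma>, \<sigma>') \<in> dec i \<longrightarrow>
            (\<exists>s'. (s, s') \<in> rel M (transfer h (pr i) 1) \<and> represents (fst M h) s' \<sigma>'))"
  proof (intro conjI allI impI)
    fix s' assume "(s, s') \<in> rel M (transfer h (pr i) 1)"
    then obtain n where "N = pr i * n" "s' = (a + int n, b)"
      unfolding N(2) rel_transfer[OF ab] by auto
    then show "\<exists>\<sigma>'. (\<sigma>, \<sigma>') \<in> dec i \<and> represents (fst M h) s' \<sigma>'"
      unfolding ab using 1[OF _ refl] by auto
  next
    fix \<sigma>' assume "(\<sigma>, \<sigma>') \<in> dec i"
    then obtain n where n: "N = pr i * n" "\<sigma>' = (\<lambda>i. multiplicity (pr i) n)"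
      using 2 by force
    then have "(s, (a + int n, b)) \<in> rel M (transfer h (pr i) 1)"
      unfolding N(2) rel_transfer[OF ab] by auto
    then show "\<exists>s'. (s, s') \<in> rel M (transfer h (pr i) 1) \<and> represents (fst M h) s' \<sigma>'"
      unfolding ab using 1[OF n] by (elim conjE) (rule exI, rule conjI)
  qed
qed

text \<open>A register is zero exactly when it cannot be decremented, and a box of falsity says that
  a program has no run.\<close>

lemma realizes_is_zero: "realizes h (Test (Box (transfer h (pr i) 1) (Bot h))) (is_zero i)"
proof -
  have "sat M (Box (transfer h (pr i) 1) (Bot h)) s \<longleftrightarrow> \<sigma> i = 0"
    if "represents (fst M h) s \<sigma>" for M :: "('b, 'a) spatial_model" and s \<sigma>
    using sat_Box_realizes[OF realizes_dec that, of "Bot h" "\<lambda>_. False"]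
    by (cases "\<sigma> i") (auto simp: dec_def simp del: sat.simps)
  then show ?thesis
    unfolding realizes_def is_zero_def by (auto simp del: sat.simps)
qed

lemma realizes_empty: "realizes h (Test (Bot h)) {}"
  by (simp add: realizes_def)

text \<open>Hiding the program lets the compilation be carried out with relations on states alone.
  The type argument fixes the atomic propositions, whose type occurs only inside the body.\<close>

definition realizable :: "'p itself \<Rightarrow> 'i \<Rightarrow> (state \<times> state) set \<Rightarrow> bool" where
  "realizable p h T \<longleftrightarrow> (\<exists>\<alpha> :: ('p, 'i) prog. realizes h \<alpha> T)"

lemma realizable_intros:
  "realizable p h (inc i)" "realizable p h (dec i)" "realizable p h (is_zero i)"
  "realizable p h {}"
  "realizable p h T \<Longrightarrow> realizable p h U \<Longrightarrow> realizable p h (T O U)"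
  "realizable p h T \<Longrightarrow> realizable p h (T\<^sup>*)"
  unfolding realizable_def
  by - ((elim exE)?, rule exI,
      rule realizes_inc realizes_dec realizes_is_zero realizes_empty realizes_Seq realizes_Iter,
      assumption?, assumption?)+


section \<open>Compiling partial recursive functions\<close>

definition clear :: "nat \<Rightarrow> (state \<times> state) set" where
  "clear i = {(\<sigma>, \<sigma>') . \<sigma>' = \<sigma>(i := 0)}"

definition move :: "nat \<Rightarrow> nat \<Rightarrow> (state \<times> state) set" where
  "move i j = {(\<sigma>, \<sigma>') . \<sigma>' = \<sigma>(j := \<sigma> j + \<sigma> i, i := 0)}"

text \<open>The auxiliary register \<open>t\<close> may have any content; if it is empty, register
  \<open>i\<close> keeps its value.\<close>

definition copy :: "nat \<Rightarrow> nat \<Rightarrow> nat \<Rightarrow> (state \<times> state) set" where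
  "copy i j t = {(\<sigma>, \<sigma>') . \<sigma>' = \<sigma>(j := \<sigma> j + \<sigma> i, i := \<sigma> i + \<sigma> t, t := 0)}"

lemma step_iff:
  "(\<sigma>, \<tau>) \<in> inc i \<longleftrightarrow> \<tau> = \<sigma>(i := Suc (\<sigma> i))"
  "(\<sigma>, \<tau>) \<in> dec i \<longleftrightarrow> (\<exists>n. \<sigma> i = Suc n \<and> \<tau> = \<sigma>(i := n))"
  "(\<sigma>, \<tau>) \<in> is_zero i \<longleftrightarrow> \<sigma> i = 0 \<and> \<tau> = \<sigma>"
  "(\<sigma>, \<tau>) \<in> clear i \<longleftrightarrow> \<tau> = \<sigma>(i := 0)"
  "(\<sigma>, \<tau>) \<in> move i j \<longleftrightarrow> \<tau> = \<sigma>(j := \<sigma> j + \<sigma> i, i := 0)"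
  "(\<sigma>, \<tau>) \<in> copy i j t \<longleftrightarrow> \<tau> = \<sigma>(j := \<sigma> j + \<sigma> i, i := \<sigma> i + \<sigma> t, t := 0)"
  by (auto simp: inc_def dec_def is_zero_def clear_def move_def copy_def)

lemma relcomp_iff: "(x, z) \<in> R O S \<longleftrightarrow> (\<exists>y. (x, y) \<in> R \<and> (y, z) \<in> S)"
  by blast

lemma ex_image_iff: "(\<exists>y. (\<exists>z. P z \<and> y = f z) \<and> Q y) \<longleftrightarrow> (\<exists>z. P z \<and> Q (f z))"
  by blast

text \<open>With these equations the simplifier executes straight-line programs symbolically, one
  instruction at a time.\<close>

lemma step_relcomp_iff:
  "(\<sigma>, \<tau>) \<in> inc i O R \<longleftrightarrow> (\<sigma>(i := Suc (\<sigma> i)), \<tau>) \<in> R"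
  "(\<sigma>, \<tau>) \<in> dec i O R \<longleftrightarrow> (\<exists>n. \<sigma> i = Suc n \<and> (\<sigma>(i := n), \<tau>) \<in> R)"
  "(\<sigma>, \<tau>) \<in> is_zero i O R \<longleftrightarrow> \<sigma> i = 0 \<and> (\<sigma>, \<tau>) \<in> R"
  "(\<sigma>, \<tau>) \<in> clear i O R \<longleftrightarrow> (\<sigma>(i := 0), \<tau>) \<in> R"
  "(\<sigma>, \<tau>) \<in> move i j O R \<longleftrightarrow> (\<sigma>(j := \<sigma> j + \<sigma> i, i := 0), \<tau>) \<in> R"
  "(\<sigma>, \<tau>) \<in> copy i j t O R \<longleftrightarrow> (\<sigma>(j := \<sigma> j + \<sigma> i, i := \<sigma> i + \<sigma> t, t := 0), \<tau>) \<in> R"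
  unfolding relcomp_iff by (auto simp: step_iff)

text \<open>The value of \<open>F\<close> is invariant under the loop body and \<open>F\<close> is
  the identity where register \<open>i\<close> is zero, so only \<open>F \<sigma>\<close> can be the
  state at exit. It is reached by induction on the content of register \<open>i\<close>.\<close>

lemma count_down:
  assumes step: "\<And>\<sigma> \<tau>. (\<sigma>, \<tau>) \<in> R \<longleftrightarrow> \<sigma> i > 0 \<and> \<tau> = g \<sigma>"
    and g: "\<And>\<sigma>. \<sigma> i > 0 \<Longrightarrow> g \<sigma> i = \<sigma> i - 1"
    and F0: "\<And>\<sigma>. \<sigma> i = 0 \<Longrightarrow> F \<sigma> = \<sigma>"
    and F: "\<And>\<sigma>. \<sigma> i > 0 \<Longrightarrow> F (g \<sigma>) = F \<sigma>"
    and Fz: "\<And>\<sigma>. F \<sigma> i = 0"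
  shows "R\<^sup>* O is_zero i = {(\<sigma>, \<tau>). \<tau> = F \<sigma>}"
proof -
  have "F \<tau> = F \<sigma>" if "(\<sigma>, \<tau>) \<in> R\<^sup>*" for \<sigma> \<tau>
    using that by (induction rule: rtrancl_induct) (simp_all add: step F)
  moreover have "(\<sigma>, F \<sigma>) \<in> R\<^sup>*" for \<sigma>
  proof (induction "\<sigma> i" arbitrary: \<sigma>)
    case 0
    then show ?case by (simp add: F0)
  next
    case (Suc n)
    then have "(g \<sigma>, F (g \<sigma>)) \<in> R\<^sup>*" by (metis diff_Suc_1 g zero_less_Suc)
    moreover have "(\<sigma>, g \<sigma>) \<in> R" using Suc.hyps(2) by (simp add: step)
    ultimately show ?case using F Suc.hyps(2) by (metis converse_rtrancl_into_rtrancl zero_less_Suc)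
  qed
  ultimately have "(\<sigma>, \<tau>) \<in> R\<^sup>* O is_zero i \<longleftrightarrow> \<tau> = F \<sigma>" for \<sigma> \<tau>
    unfolding relcomp_iff[of _ _ "R\<^sup>*"] step_iff by (metis F0 Fz)
  then show ?thesis by auto
qed

lemma clear_eq: "(dec i)\<^sup>* O is_zero i = clear i"
  unfolding clear_def
  by (rule count_down[where g = "\<lambda>\<sigma>. \<sigma>(i := \<sigma> i - 1)"]) (auto simp: step_iff gr0_conv_Suc)

lemma move_eq:
  assumes "i \<noteq> j"
  shows "(dec i O inc j)\<^sup>* O is_zero i = move i j"
  unfolding move_def
proof (rule count_down[where g = "\<lambda>\<sigma>. \<sigma>(i := \<sigma> i - 1, j := Suc (\<sigma> j))"])
  show "(\<sigma>, \<tau>) \<in> dec i O inc j \<longleftrightarrow> \<sigma> i > 0 \<and> \<tau> = \<sigma>(i := \<sigma> i - 1, j := Suc (\<sigma> j))" for \<sigma> \<tau>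
    using assms by (auto simp: step_iff step_relcomp_iff gr0_conv_Suc)
qed (use assms in \<open>simp_all add: fun_eq_iff\<close>)

text \<open>The loop empties \<open>i\<close> into both \<open>j\<close> and \<open>t\<close>;
  moving \<open>t\<close> back restores \<open>i\<close>.\<close>

lemma copy_eq:
  assumes "distinct [i, j, t]"
  shows "((dec i O inc j O inc t)\<^sup>* O is_zero i) O move t i = copy i j t"
proof -
  have "(dec i O inc j O inc t)\<^sup>* O is_zero i
      = {(\<sigma>, \<tau>). \<tau> = \<sigma>(j := \<sigma> j + \<sigma> i, t := \<sigma> t + \<sigma> i, i := 0)}"
  proof (rule count_down[where g = "\<lambda>\<sigma>. \<sigma>(i := \<sigma> i - 1, j := Suc (\<sigma> j), t := Suc (\<sigma> t))"])
    show "(\<sigma>, \<tau>) \<in> dec i O inc j O inc t \<longleftrightarrow>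
        \<sigma> i > 0 \<and> \<tau> = \<sigma>(i := \<sigma> i - 1, j := Suc (\<sigma> j), t := Suc (\<sigma> t))" for \<sigma> \<tau>
      using assms by (auto simp: step_iff step_relcomp_iff gr0_conv_Suc)
  qed (use assms in \<open>simp_all add: fun_eq_iff\<close>)
  then show ?thesis
    using assms by (auto simp: move_def copy_def relcomp_unfold add.commute)
qed

lemma realizable_clear: "realizable p h (clear i)"
  unfolding clear_eq[symmetric] by (intro realizable_intros)

lemma realizable_move: "i \<noteq> j \<Longrightarrow> realizable p h (move i j)"
  unfolding move_eq[symmetric] by (intro realizable_intros)

lemma realizable_copy: "distinct [i, j, t] \<Longrightarrow> realizable p h (copy i j t)"
  unfolding copy_eq[symmetric] by (intro realizable_intros realizable_move) auto

lemmas realizable_macros = realizable_intros realizable_clear realizable_move realizable_copy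

section \<open>Correctness of compiled programs\<close>

definition clean :: "nat \<Rightarrow> state set" where
  "clean k = {\<sigma>. \<forall>i\<ge>k. \<sigma> i = 0}"

text \<open>The registers from \<open>k\<close> on are scratch space, empty before and after the computation.
  The result is added to the output register, so that nothing needs to be assumed about its
  initial content.\<close>

definition computes :: "(state \<times> state) set \<Rightarrow> nat \<Rightarrow> recf \<Rightarrow> nat list \<Rightarrow> nat \<Rightarrow> bool" where
  "computes T k f args out \<longleftrightarrow> (\<forall>\<sigma>\<in>clean k. \<forall>\<sigma>'. (\<sigma>, \<sigma>') \<in> T \<longleftrightarrow>
    (\<exists>y. eval f (map \<sigma> args) y \<and> \<sigma>' = \<sigma>(out := \<sigma> out + y)))"

text \<open>All register layouts are covered because a composite function calls its components on
  registers of its own choice, with scratch space further up. As \<open>out\<close> is not among the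
  arguments, these survive the computation.\<close>

definition compilable :: "'p itself \<Rightarrow> 'i \<Rightarrow> recf \<Rightarrow> bool" where
  "compilable p h f \<longleftrightarrow> (\<forall>k args out. set args \<subseteq> {..<k} \<longrightarrow> out < k \<longrightarrow> out \<notin> set args \<longrightarrow>
    (\<exists>T. realizable p h T \<and> computes T k f args out))"

lemma compilableD:
  assumes "compilable p h f" "set args \<subseteq> {..<k}" "out < k" "out \<notin> set args"
  obtains T where "realizable p h T" "computes T k f args out"
  using assms unfolding compilable_def by blast

lemma computesD:
  "computes T k f args out \<Longrightarrow> \<sigma> \<in> clean k \<Longrightarrow> (\<sigma>, \<sigma>') \<in> T \<longleftrightarrow>
    (\<exists>y. eval f (map \<sigma> args) y \<and> \<sigma>' = \<sigma>(out := \<sigma> out + y))"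
  unfolding computes_def by blast

lemma cleanD: "\<sigma> \<in> clean k \<Longrightarrow> k \<le> i \<Longrightarrow> \<sigma> i = 0"
  unfolding clean_def by auto

lemma map_upd: "i \<notin> set xs \<Longrightarrow> map (f(i := x)) xs = map f xs"
  by auto

section \<open>Zero, successor and projections\<close>

lemma compilable_Zero: "compilable p h Zero"
  unfolding compilable_def
proof (intro allI impI exI conjI)
  fix k out :: nat and args :: "nat list"
  \<comment> \<open>\<open>{}\<^sup>*\<close> is the identity relation; adding 0 to the output
    changes nothing.\<close>
  show "realizable p h ({}\<^sup>*)" by (intro realizable_intros)
  show "computes ({}\<^sup>*) k Zero args out"
    unfolding computes_def by (auto intro: eval.intros elim: eval_ZeroE)
qed

lemma compilable_Succ: "compilable p h Succ"
  unfolding compilable_def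
proof (intro allI impI)
  fix k out :: nat and args :: "nat list"
  assume A: "set args \<subseteq> {..<k}" "out < k" "out \<notin> set args"
  show "\<exists>T. realizable p h T \<and> computes T k Succ args out"
  proof (cases "\<exists>a. args = [a]")
    case True
    then obtain a where a: "args = [a]" ..
    \<comment> \<open>Register \<open>k\<close> is the first scratch register; being empty, it
      leaves the argument intact.\<close>
    have "realizable p h (copy a out k O inc out)"
      using A a by (intro realizable_macros) auto
    moreover have "eval Succ [x] y \<longleftrightarrow> y = Suc x" for x y
      by (auto intro: eval.intros elim: eval_SuccE)
    then have "computes (copy a out k O inc out) k Succ args out"
      unfolding computes_def using A a
      by (auto simp: step_iff step_relcomp_iff cleanD fun_eq_iff)
    ultimately show ?thesis by blast
  next
    \<comment> \<open>For any other number of arguments nothing is defined, which matches a program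
      without runs.\<close>
    case False
    then have "\<not> eval Succ (map \<sigma> args) y" for \<sigma> y
      by (auto elim!: eval_SuccE)
    then have "computes {} k Succ args out" unfolding computes_def by blast
    then show ?thesis using realizable_intros(4)[of p h] by blast
  qed
qed

lemma compilable_Proj: "compilable p h (Proj i)"
  unfolding compilable_def
proof (intro allI impI)
  fix k out :: nat and args :: "nat list"
  assume A: "set args \<subseteq> {..<k}" "out < k" "out \<notin> set args"
  show "\<exists>T. realizable p h T \<and> computes T k (Proj i) args out"
  proof (cases "i < length args")
    case True
    then have a: "args ! i \<in> set args" by simp
    with A have "args ! i \<noteq> out" "args ! i < k" by auto
    with A(2) have d: "distinct [args ! i, out, k]" by auto
    have "eval (Proj i) (map \<sigma> args) y \<longleftrightarrow> y = \<sigma> (args ! i)" for \<sigma> y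
      using True eval_Proj[of i "map \<sigma> args"] by (auto elim: eval_ProjE)
    then have "computes (copy (args ! i) out k) k (Proj i) args out"
      unfolding computes_def using d
      by (auto simp: step_iff cleanD fun_eq_iff)
    then show ?thesis using realizable_copy[OF d, of p h] by blast
  next
    case False
    then have "\<not> eval (Proj i) (map \<sigma> args) y" for \<sigma> y
      by (auto elim!: eval_ProjE)
    then have "computes {} k (Proj i) args out" unfolding computes_def by blast
    then show ?thesis using realizable_intros(4)[of p h] by blast
  qed
qed

section \<open>Composition\<close>

primrec fill :: "nat \<Rightarrow> nat list \<Rightarrow> state \<Rightarrow> state" where
  "fill j [] \<sigma> = \<sigma>"
| "fill j (y # ys) \<sigma> = fill (Suc j) ys (\<sigma>(j := y))"

lemma fill_apply:
  "fill j ys \<sigma> i = (if j \<le> i \<and> i < j + length ys then ys ! (i - j) else \<sigma> i)"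
  by (induction ys arbitrary: j \<sigma>) (auto simp: nth_Cons' Suc_diff_Suc)

text \<open>Each result goes to the first scratch register, so the scratch space of the remaining
  functions starts one register higher; hence the induction with arbitrary \<open>j\<close>.\<close>

lemma compile_arguments:
  assumes "\<forall>g\<in>set gs. compilable p h g" and "set args \<subseteq> {..<j}"
  shows "\<exists>T. realizable p h T \<and> (\<forall>\<sigma>\<in>clean j. \<forall>\<sigma>'. (\<sigma>, \<sigma>') \<in> T \<longleftrightarrow>
    (\<exists>ys. list_all2 (\<lambda>g y. eval g (map \<sigma> args) y) gs ys \<and> \<sigma>' = fill j ys \<sigma>))"
  using assms
proof (induction gs arbitrary: j)
  case Nil
  have "realizable p h ({}\<^sup>*)" by (intro realizable_intros)
  then show ?case by (intro exI[of _ "{}\<^sup>*"]) auto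
next
  case (Cons g gs)
  have j: "j \<notin> set args" using Cons.prems(2) by auto
  obtain T where T: "realizable p h T" "computes T (Suc j) g args j"
    by (rule compilableD[of p h g args "Suc j" j]) (use Cons.prems j in auto)
  have gs: "\<forall>g\<in>set gs. compilable p h g"
    using Cons.prems(1) by simp
  have "set args \<subseteq> {..<Suc j}" using Cons.prems(2) by auto
  from Cons.IH[OF gs this] obtain U where U: "realizable p h U"
    "\<forall>\<sigma>\<in>clean (Suc j). \<forall>\<sigma>'. (\<sigma>, \<sigma>') \<in> U \<longleftrightarrow>
      (\<exists>ys. list_all2 (\<lambda>g y. eval g (map \<sigma> args) y) gs ys \<and> \<sigma>' = fill (Suc j) ys \<sigma>)"
    by (elim exE conjE)
  have "(\<sigma>, \<sigma>') \<in> T O U \<longleftrightarrow>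
      (\<exists>ys. list_all2 (\<lambda>g y. eval g (map \<sigma> args) y) (g # gs) ys \<and> \<sigma>' = fill j ys \<sigma>)"
    if \<sigma>: "\<sigma> \<in> clean j" for \<sigma> \<sigma>'
  proof -
    have c: "\<sigma> \<in> clean (Suc j)" "\<sigma>(j := x) \<in> clean (Suc j)" for x
      using \<sigma> by (auto simp: clean_def)
    have *: "(\<sigma>(j := y), \<sigma>') \<in> U \<longleftrightarrow>
        (\<exists>ys. list_all2 (\<lambda>g y. eval g (map \<sigma> args) y) gs ys \<and> \<sigma>' = fill j (y # ys) \<sigma>)" for y
      using U(2)[rule_format, OF c(2)] by (simp only: map_upd[OF j] fill.simps)
    have "(\<sigma>, \<sigma>') \<in> T O U \<longleftrightarrow> (\<exists>y. eval g (map \<sigma> args) y \<and> (\<sigma>(j := y), \<sigma>') \<in> U)"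
      unfolding relcomp_iff[of _ _ T]
      by (auto simp: computesD[OF T(2) c(1)] cleanD[OF \<sigma>])
    also have "\<dots> \<longleftrightarrow>
        (\<exists>ys. list_all2 (\<lambda>g y. eval g (map \<sigma> args) y) (g # gs) ys \<and> \<sigma>' = fill j ys \<sigma>)"
      unfolding * list_all2_Cons1 by blast
    finally show ?thesis .
  qed
  then show ?case using realizable_intros(5)[OF T(1) U(1)] by blast
qed

text \<open>This removes the intermediate results of a composition, so that the scratch space is
  left empty.\<close>

lemma realizable_clear_range:
  "\<exists>T. realizable p h T \<and>
    (\<forall>\<sigma> \<sigma>'. (\<sigma>, \<sigma>') \<in> T \<longleftrightarrow> \<sigma>' = (\<lambda>i. if j \<le> i \<and> i < j + n then 0 else \<sigma> i))"
proof (induction n)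
  case 0
  have "realizable p h ({}\<^sup>*)" by (intro realizable_intros)
  then show ?case by (intro exI[of _ "{}\<^sup>*"]) auto
next
  case (Suc n)
  then obtain T where T: "realizable p h T"
    "\<forall>\<sigma> \<sigma>'. (\<sigma>, \<sigma>') \<in> T \<longleftrightarrow> \<sigma>' = (\<lambda>i. if j \<le> i \<and> i < j + n then 0 else \<sigma> i)"
    by (elim exE conjE)
  have 1: "realizable p h (T O clear (j + n))"
    using T(1) by (intro realizable_macros)
  have "(\<lambda>i. if j \<le> i \<and> i < j + n then 0 else \<sigma> i)(j + n := 0) =
      (\<lambda>i. if j \<le> i \<and> i < j + Suc n then 0 else \<sigma> i)" for \<sigma> :: state
    by (rule ext) auto
  then have 2: "(\<sigma>, \<sigma>') \<in> T O clear (j + n) \<longleftrightarrow>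
      \<sigma>' = (\<lambda>i. if j \<le> i \<and> i < j + Suc n then 0 else \<sigma> i)" for \<sigma> \<sigma>'
    unfolding relcomp_iff[of _ _ T] by (simp add: T(2)[rule_format] step_iff)
  show ?case by (rule exI, rule conjI[OF 1], intro allI, rule 2)
qed

lemma eval_Comp_iff:
  "eval (Comp f gs) xs z \<longleftrightarrow> (\<exists>ys. list_all2 (\<lambda>g y. eval g xs y) gs ys \<and> eval f ys z)"
  by (auto elim: eval_CompE intro: eval_Comp)

lemma eval_Mu_iff:
  "eval (Mu f) xs n \<longleftrightarrow> (\<forall>m<n. \<exists>z. eval f (m # xs) (Suc z)) \<and> eval f (n # xs) 0"
  by (auto elim: eval_MuE intro: eval_Mu)

text \<open>\<open>T\<close> stores the values of \<open>gs\<close> in the \<open>n\<close>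
  registers from \<open>k\<close> on, \<open>U\<close> applies \<open>f\<close> to them with scratch
  space from \<open>k + n\<close> on, and \<open>V\<close> empties them again.\<close>

lemma compilable_Comp:
  assumes f: "compilable p h f" and gs: "\<forall>g\<in>set gs. compilable p h g"
  shows "compilable p h (Comp f gs)"
  unfolding compilable_def
proof (intro allI impI)
  fix k out :: nat and args :: "nat list"
  assume A: "set args \<subseteq> {..<k}" "out < k" "out \<notin> set args"
  define n where "n = length gs"
  from compile_arguments[OF gs A(1)] obtain T where T: "realizable p h T"
    "\<forall>\<sigma>\<in>clean k. \<forall>\<sigma>'. (\<sigma>, \<sigma>') \<in> T \<longleftrightarrow>
      (\<exists>ys. list_all2 (\<lambda>g y. eval g (map \<sigma> args) y) gs ys \<and> \<sigma>' = fill k ys \<sigma>)"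
    by (elim exE conjE)
  obtain U where U: "realizable p h U" "computes U (k + n) f [k..<k + n] out"
    by (rule compilableD[OF f, of "[k..<k + n]" "k + n" out]) (use A(2) in auto)
  from realizable_clear_range[of p h k n] obtain V where V: "realizable p h V"
    "\<forall>\<sigma> \<sigma>'. (\<sigma>, \<sigma>') \<in> V \<longleftrightarrow> \<sigma>' = (\<lambda>i. if k \<le> i \<and> i < k + n then 0 else \<sigma> i)"
    by (elim exE conjE)
  have "computes (T O U O V) k (Comp f gs) args out"
    unfolding computes_def
  proof (intro ballI allI)
    fix \<sigma> \<sigma>' assume \<sigma>: "\<sigma> \<in> clean k"
    have 1: "(fill k ys \<sigma>, \<sigma>') \<in> U O V \<longleftrightarrow> (\<exists>y. eval f ys y \<and> \<sigma>' = \<sigma>(out := \<sigma> out + y))"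
      if "length ys = n" for ys
    proof -
      have c: "fill k ys \<sigma> \<in> clean (k + n)"
        using \<sigma> that by (auto simp: clean_def fill_apply)
      have m: "map (fill k ys \<sigma>) [k..<k + n] = ys"
        using that by (intro nth_equalityI) (auto simp: fill_apply)
      have "(\<lambda>i. if k \<le> i \<and> i < k + n then 0
          else ((fill k ys \<sigma>)(out := fill k ys \<sigma> out + y)) i) = \<sigma>(out := \<sigma> out + y)" for y
        using that A(2) cleanD[OF \<sigma>] by (auto simp: fun_eq_iff fill_apply)
      then show ?thesis
        unfolding relcomp_iff[of _ _ U] by (auto simp: computesD[OF U(2) c] V(2)[rule_format] m)
    qed
    have "(\<sigma>, \<sigma>') \<in> T O U O V \<longleftrightarrow> (\<exists>ys. list_all2 (\<lambda>g y. eval g (map \<sigma> args) y) gs ys \<and>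
        (fill k ys \<sigma>, \<sigma>') \<in> U O V)"
      unfolding relcomp_iff[of _ _ T] using T(2)[rule_format, OF \<sigma>] by auto
    also have "\<dots> \<longleftrightarrow> (\<exists>ys. list_all2 (\<lambda>g y. eval g (map \<sigma> args) y) gs ys \<and>
        (\<exists>y. eval f ys y \<and> \<sigma>' = \<sigma>(out := \<sigma> out + y)))"
      using 1 n_def list_all2_lengthD by metis
    also have "\<dots> \<longleftrightarrow> (\<exists>y. eval (Comp f gs) (map \<sigma> args) y \<and> \<sigma>' = \<sigma>(out := \<sigma> out + y))"
      unfolding eval_Comp_iff by blast
    finally show "(\<sigma>, \<sigma>') \<in> T O U O V \<longleftrightarrow>
      (\<exists>y. eval (Comp f gs) (map \<sigma> args) y \<and> \<sigma>' = \<sigma>(out := \<sigma> out + y))" .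
  qed
  moreover have "realizable p h (T O U O V)"
    using T(1) U(1) V(1) by (intro realizable_intros)
  ultimately show "\<exists>T. realizable p h T \<and> computes T k (Comp f gs) args out" by blast
qed

section \<open>Primitive recursion and unbounded search\<close>

lemma compilable_PrimRec:
  assumes f: "compilable p h f" and g: "compilable p h g"
  shows "compilable p h (PrimRec f g)"
  unfolding compilable_def
proof (intro allI impI)
  fix k out :: nat and args :: "nat list"
  assume A: "set args \<subseteq> {..<k}" "out < k" "out \<notin> set args"
  show "\<exists>T. realizable p h T \<and> computes T k (PrimRec f g) args out"
  proof (cases args)
    case Nil
    have "\<not> eval (PrimRec f g) [] y" for y
      by (auto elim: eval.cases)
    with Nil have "computes {} k (PrimRec f g) args out" unfolding computes_def by simp
    then show ?thesis using realizable_intros(4)[of p h] by blast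
  next
    case (Cons a as)
    \<comment> \<open>\<open>c\<close> counts the completed rounds, \<open>acc\<close> holds the
      value of the recursion at \<open>c\<close>, \<open>new\<close> receives the next value, and
      \<open>rm\<close> counts the remaining rounds. Scratch space for \<open>f\<close> and
      \<open>g\<close> starts at \<open>k + 4\<close>.\<close>
    define c acc new rm where r: "c = k" "acc = k + 1" "new = k + 2" "rm = k + 3"
    have as: "a < k" "a \<noteq> out" "set as \<subseteq> {..<k}" "out \<notin> set as" using A Cons by auto
    obtain F where F: "realizable p h F" "computes F (k + 4) f as acc"
      by (rule compilableD[OF f, of as "k + 4" acc]) (use as in \<open>auto simp: r\<close>)
    obtain G where G: "realizable p h G" "computes G (k + 4) g (c # acc # as) new"
      by (rule compilableD[OF g, of "c # acc # as" "k + 4" new]) (use as in \<open>auto simp: r\<close>)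
    \<comment> \<open>The detour through \<open>new\<close> is due to \<open>acc\<close> being an
      argument of \<open>g\<close>, which cannot be its output as well.\<close>
    define B where "B = dec rm O G O clear acc O move new acc O inc c"
    define T where
      "T = copy a rm (k + 4) O F O B\<^sup>* O is_zero rm O move acc out O clear c"
    have "realizable p h T"
      unfolding T_def B_def using F(1) G(1) as A(2)
      by (intro realizable_macros) (auto simp: r)
    moreover have "computes T k (PrimRec f g) args out"
      unfolding computes_def
    proof (intro ballI allI)
      fix \<sigma> \<sigma>' assume \<sigma>: "\<sigma> \<in> clean k"
      define xs where "xs = map \<sigma> as"
      \<comment> \<open>The state between two rounds: \<open>n\<close> rounds done, \<open>m\<close>
        remaining, current value \<open>y\<close>, all other registers as at the beginning.\<close>
      define S where "S n m y = \<sigma>(c := n, rm := m, acc := y)" for n m y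
      have S_rm: "S n m y rm = m" for n m y by (simp add: S_def r)
      have S_upd_rm: "(S n m y)(rm := m') = S n m' y" for n m y m'
        by (rule ext) (simp add: S_def r)
      have B: "(S n m y, \<tau>) \<in> B \<longleftrightarrow>
          (\<exists>m' z. m = Suc m' \<and> eval g (n # y # xs) z \<and> \<tau> = S (Suc n) m' z)" for n m y \<tau>
      proof -
        have c: "S n m y \<in> clean (k + 4)" for m
          using \<sigma> by (auto simp: S_def clean_def r)
        have m: "map (S n m y) (c # acc # as) = n # y # xs" for m
          using as by (auto simp: S_def xs_def r)
        have 1: "(S n m y, \<tau>) \<in> dec rm \<longleftrightarrow> (\<exists>m'. m = Suc m' \<and> \<tau> = S n m' y)" for \<tau>
          unfolding step_iff S_rm S_upd_rm by (rule refl)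
        have 2: "(S n m y, \<tau>) \<in> G \<longleftrightarrow>
            (\<exists>z. eval g (n # y # xs) z \<and> \<tau> = (S n m y)(new := z))" for m \<tau>
          unfolding computesD[OF G(2) c] m
          using cleanD[OF \<sigma>, of new] by (simp add: S_def r)
        have 3: "((S n m y)(new := z), \<tau>) \<in> clear acc O move new acc O inc c \<longleftrightarrow>
            \<tau> = S (Suc n) m z" for m z \<tau>
          unfolding step_relcomp_iff step_iff using cleanD[OF \<sigma>, of new]
          by (intro arg_cong[where f = "(=) \<tau>"] ext) (simp add: S_def r)
        show ?thesis
          unfolding B_def relcomp_iff[of _ _ "dec rm"] relcomp_iff[of _ _ G]
          by (simp add: 1) (metis 2 3)
      qed
      \<comment> \<open>The loop invariant: the two counters add up to \<open>N\<close>, and the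
        accumulator holds the value at the number of completed rounds.\<close>
      have sound: "\<exists>n m y. \<tau> = S n m y \<and> n + m = N \<and> eval (PrimRec f g) (n # xs) y"
        if "(S 0 N y0, \<tau>) \<in> B\<^sup>*" "eval f xs y0" for N y0 \<tau>
        using that(1)
      proof (induction rule: rtrancl_induct)
        case base
        then show ?case using that(2) by (blast intro: eval_PrimRec_0 add_0)
      next
        case (step \<tau> \<tau>')
        then show ?case using B by (metis add_Suc_shift eval_PrimRec_Suc)
      qed
      \<comment> \<open>\<open>m\<close> must vary in the induction, since reaching round
        \<open>n\<close> before its last step leaves one more round to do.\<close>
      have complete: "\<exists>y0. eval f xs y0 \<and> (S 0 (n + m) y0, S n m y) \<in> B\<^sup>*"
        if "eval (PrimRec f g) (n # xs) y" for n m y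
        using that
      proof (induction n arbitrary: m y)
        case 0
        then show ?case by (auto elim: eval_PrimRec_0E)
      next
        case (Suc n)
        from Suc.prems obtain z where z: "eval (PrimRec f g) (n # xs) z" "eval g (n # z # xs) y"
          by (rule eval_PrimRec_SucE)
        obtain y0 where y0: "eval f xs y0" "(S 0 (n + Suc m) y0, S n (Suc m) z) \<in> B\<^sup>*"
          using Suc.IH[OF z(1)] by blast
        moreover have "(S n (Suc m) z, S (Suc n) m y) \<in> B" using B z(2) by blast
        ultimately show ?case by (metis add_Suc_shift rtrancl.rtrancl_into_rtrancl)
      qed
      \<comment> \<open>The exit test forces \<open>m = 0\<close> in the invariant, so exactly
        \<open>N\<close> rounds have been done.\<close>
      have loop: "(\<exists>y0. eval f xs y0 \<and> (S 0 N y0, \<tau>) \<in> B\<^sup>* O is_zero rm) \<longleftrightarrow>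
          (\<exists>y. eval (PrimRec f g) (N # xs) y \<and> \<tau> = S N 0 y)" for N \<tau>
        unfolding relcomp_iff[of _ _ "B\<^sup>*"] step_iff
        using sound complete[of N _ 0] S_rm by (metis add.right_neutral)
      have init: "(\<sigma>, \<tau>) \<in> copy a rm (k + 4) O F \<longleftrightarrow>
          (\<exists>y0. eval f xs y0 \<and> \<tau> = S 0 (\<sigma> a) y0)" for \<tau>
      proof -
        have "\<sigma>(rm := \<sigma> rm + \<sigma> a, a := \<sigma> a + \<sigma> (k + 4), k + 4 := 0) = S 0 (\<sigma> a) 0"
          using cleanD[OF \<sigma>] as by (intro ext) (simp add: S_def r)
        moreover have "S 0 (\<sigma> a) 0 \<in> clean (k + 4)"
          using \<sigma> by (auto simp: S_def clean_def r)
        moreover have "map (S 0 (\<sigma> a) 0) as = xs" using as by (auto simp: S_def xs_def r)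
        moreover have "(S 0 (\<sigma> a) 0)(acc := S 0 (\<sigma> a) 0 acc + y) = S 0 (\<sigma> a) y" for y
          by (simp add: S_def)
        ultimately show ?thesis
          by (simp add: step_relcomp_iff computesD[OF F(2)])
      qed
      have finish: "(S n 0 y, \<tau>) \<in> move acc out O clear c \<longleftrightarrow> \<tau> = \<sigma>(out := \<sigma> out + y)" for n y \<tau>
        unfolding step_relcomp_iff step_iff using cleanD[OF \<sigma>] A(2)
        by (intro arg_cong[where f = "(=) \<tau>"] ext) (simp add: S_def r)
      \<comment> \<open>Regrouped to match the three phases described by \<open>init\<close>,
        \<open>loop\<close> and \<open>finish\<close>.\<close>
      have "T = (copy a rm (k + 4) O F) O (B\<^sup>* O is_zero rm) O (move acc out O clear c)"
        by (simp add: T_def O_assoc)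
      then have "(\<sigma>, \<sigma>') \<in> T \<longleftrightarrow> (\<exists>\<tau>. (\<exists>y0. eval f xs y0 \<and> (S 0 (\<sigma> a) y0, \<tau>) \<in> B\<^sup>* O is_zero rm)
          \<and> (\<tau>, \<sigma>') \<in> move acc out O clear c)"
        by (simp only: relcomp_iff[of _ _ "copy a rm (k + 4) O F"]
            relcomp_iff[of _ _ "B\<^sup>* O is_zero rm"] init) metis
      also have "\<dots> \<longleftrightarrow> (\<exists>y. eval (PrimRec f g) (\<sigma> a # xs) y \<and> \<sigma>' = \<sigma>(out := \<sigma> out + y))"
        unfolding loop by (simp only: ex_simps(1)[symmetric] conj_assoc) (metis finish)
      finally show "(\<sigma>, \<sigma>') \<in> T \<longleftrightarrow>
          (\<exists>y. eval (PrimRec f g) (map \<sigma> args) y \<and> \<sigma>' = \<sigma>(out := \<sigma> out + y))"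
        unfolding xs_def Cons list.map .
    qed
    ultimately show ?thesis by blast
  qed
qed

text \<open>Register \<open>c\<close> holds the candidate and \<open>v\<close> the value of
  \<open>f\<close> there. Continuing requires a positive value and stopping requires zero, so the
  nondeterministic loop can end only at the least zero; an undefined value blocks both.\<close>

lemma compilable_Mu:
  assumes f: "compilable p h f"
  shows "compilable p h (Mu f)"
  unfolding compilable_def
proof (intro allI impI)
  fix k out :: nat and args :: "nat list"
  assume A: "set args \<subseteq> {..<k}" "out < k" "out \<notin> set args"
  define c v where r: "c = k" "v = k + 1"
  obtain F where F: "realizable p h F" "computes F (k + 2) f (c # args) v"
    by (rule compilableD[OF f, of "c # args" "k + 2" v]) (use A in \<open>auto simp: r\<close>)
  \<comment> \<open>\<open>dec v\<close> is the test for a positive value; the rest of that value is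
    then discarded.\<close>
  define B where "B = F O dec v O clear v O inc c"
  \<comment> \<open>The final evaluation must give zero, which leaves \<open>v\<close> empty; moving
    the candidate to the output empties \<open>c\<close>.\<close>
  define T where "T = B\<^sup>* O F O is_zero v O move c out"
  have "realizable p h T"
    unfolding T_def B_def using F(1) A(2) by (intro realizable_macros) (auto simp: r)
  moreover have "computes T k (Mu f) args out"
    unfolding computes_def
  proof (intro ballI allI)
    fix \<sigma> \<sigma>' assume \<sigma>: "\<sigma> \<in> clean k"
    define xs where "xs = map \<sigma> args"
    define S where "S n = \<sigma>(c := n)" for n
    have S_c: "S n c = n" for n by (simp add: S_def)
    have S_inc: "(S n)(v := 0, c := Suc n) = S (Suc n)" for n
      using cleanD[OF \<sigma>, of v] by (intro ext) (simp add: S_def r)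
    have S_out: "(S n)(v := 0, out := \<sigma> out + n, c := 0) = \<sigma>(out := \<sigma> out + n)" for n
      using cleanD[OF \<sigma>] A(2) by (intro ext) (simp add: S_def r)
    have F': "(S n, \<tau>) \<in> F \<longleftrightarrow> (\<exists>z. eval f (n # xs) z \<and> \<tau> = (S n)(v := z))" for n \<tau>
    proof -
      have c: "S n \<in> clean (k + 2)" using \<sigma> by (auto simp: S_def clean_def r)
      have m: "map (S n) (c # args) = n # xs" using A by (auto simp: S_def xs_def r)
      show ?thesis
        unfolding computesD[OF F(2) c] m using cleanD[OF \<sigma>, of v] by (auto simp: S_def r)
    qed
    have B: "(S n, \<tau>) \<in> B \<longleftrightarrow> (\<exists>z. eval f (n # xs) (Suc z) \<and> \<tau> = S (Suc n))" for n \<tau>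
    proof -
      have *: "((S n)(v := z), \<tau>) \<in> dec v O clear v O inc c \<longleftrightarrow> z > 0 \<and> \<tau> = S (Suc n)" for z \<tau>
        using S_inc S_c r by (cases z) (simp_all add: step_iff step_relcomp_iff)
      show ?thesis
        unfolding B_def relcomp_iff[of _ _ F] F' ex_image_iff * by (auto simp: gr0_conv_Suc)
    qed
    have finish: "(S n, \<tau>) \<in> F O is_zero v O move c out \<longleftrightarrow>
        eval f (n # xs) 0 \<and> \<tau> = \<sigma>(out := \<sigma> out + n)" for n \<tau>
    proof -
      have *: "((S n)(v := z), \<tau>) \<in> is_zero v O move c out \<longleftrightarrow>
          z = 0 \<and> \<tau> = \<sigma>(out := \<sigma> out + n)" for z \<tau>
        using S_out[of n] S_c A(2) r by (cases z) (simp_all add: step_iff step_relcomp_iff S_def)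
      show ?thesis
        unfolding relcomp_iff[of _ _ F] F' ex_image_iff * by auto
    qed
    have sound: "\<exists>n. \<tau> = S n \<and> (\<forall>m<n. \<exists>z. eval f (m # xs) (Suc z))" if "(S 0, \<tau>) \<in> B\<^sup>*" for \<tau>
      using that
    proof (induction rule: rtrancl_induct)
      case base
      then show ?case by blast
    next
      case (step \<tau> \<tau>')
      then show ?case using B by (metis less_Suc_eq)
    qed
    have complete: "(S 0, S n) \<in> B\<^sup>*" if "\<forall>m<n. \<exists>z. eval f (m # xs) (Suc z)" for n
      using that
    proof (induction n)
      case (Suc n)
      then have "(S 0, S n) \<in> B\<^sup>*" by simp
      moreover have "(S n, S (Suc n)) \<in> B" using B Suc.prems by auto
      ultimately show ?case by (rule rtrancl_into_rtrancl)
    qed simp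
    have "\<sigma> = S 0" using cleanD[OF \<sigma>, of c] by (auto simp: S_def r)
    then have reach: "(\<sigma>, \<tau>) \<in> B\<^sup>* \<longleftrightarrow>
        (\<exists>n. (\<forall>m<n. \<exists>z. eval f (m # xs) (Suc z)) \<and> \<tau> = S n)" for \<tau>
      using sound complete by auto
    have "(\<sigma>, \<sigma>') \<in> T \<longleftrightarrow> (\<exists>n. (\<forall>m<n. \<exists>z. eval f (m # xs) (Suc z)) \<and>
        eval f (n # xs) 0 \<and> \<sigma>' = \<sigma>(out := \<sigma> out + n))"
      unfolding T_def relcomp_iff[of _ _ "B\<^sup>*"] reach ex_image_iff finish by (rule refl)
    also have "\<dots> \<longleftrightarrow> (\<exists>y. eval (Mu f) xs y \<and> \<sigma>' = \<sigma>(out := \<sigma> out + y))"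
      unfolding eval_Mu_iff by blast
    finally show "(\<sigma>, \<sigma>') \<in> T \<longleftrightarrow> (\<exists>y. eval (Mu f) (map \<sigma> args) y \<and> \<sigma>' = \<sigma>(out := \<sigma> out + y))"
      unfolding xs_def .
  qed
  ultimately show "\<exists>T. realizable p h T \<and> computes T k (Mu f) args out" by blast
qed

lemma compilable: "compilable p h f"
proof (induction f)
  case (Comp f gs)
  then show ?case by (intro compilable_Comp ballI)
qed (assumption | rule compilable_Zero compilable_Succ compilable_Proj compilable_PrimRec compilable_Mu)+

section \<open>Diagonalisation\<close>

text \<open>The test makes a box over this program vacuous away from the agent. The step to the
  right leads to \<open>N = 1\<close>, where all registers are empty.\<close>

definition start :: "'i \<Rightarrow> ('p, 'i) prog" where
  "start h = Seq (Test (Here h)) Rgt"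

text \<open>One box per increment makes the code of the result a primitive recursion on
  \<open>n\<close>, with the code of \<open>\<chi>\<close> as parameter.\<close>

primrec feed :: "'i \<Rightarrow> nat \<Rightarrow> ('p, 'i) fm \<Rightarrow> ('p, 'i) fm" where
  "feed h 0 \<chi> = \<chi>"
| "feed h (Suc n) \<chi> = Box (transfer h 1 (pr 0)) (feed h n \<chi>)"

text \<open>\<open>inc 0\<close> is total and single-valued, so each box just adds one to register
  0.\<close>

lemma sat_feed:
  assumes "\<And>s \<sigma>. represents (fst M h) s \<sigma> \<Longrightarrow> sat M \<chi> s \<longleftrightarrow> Q \<sigma>"
    and "represents (fst M h) s \<sigma>"
  shows "sat M (feed h n \<chi>) s \<longleftrightarrow> Q (\<sigma>(0 := \<sigma> 0 + n))"
  using assms(2)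
proof (induction n arbitrary: s \<sigma>)
  case 0
  then show ?case using assms(1) by simp
next
  case (Suc n)
  have "sat M (feed h (Suc n) \<chi>) s \<longleftrightarrow>
      (\<forall>\<sigma>'. (\<sigma>, \<sigma>') \<in> inc 0 \<longrightarrow> Q (\<sigma>'(0 := \<sigma>' 0 + n)))"
    unfolding feed.simps by (rule sat_Box_realizes[OF realizes_inc Suc.prems Suc.IH])
  then show ?case by (simp add: step_iff fun_upd_def cong: if_cong)
qed

text \<open>Away from the agent the formula holds vacuously. At the agent its truth depends on
  \<open>T\<close> and \<open>n\<close> alone, and not on the model.\<close>

lemma valid_feed:
  assumes "realizes h \<alpha> T"
  shows "valid (Box (start h) (feed h n (Box \<alpha> (Bot h)))) \<longleftrightarrow>
    (\<nexists>\<sigma>. ((\<lambda>i. 0)(0 := n), \<sigma>) \<in> T)"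
proof -
  have "sat M (Box (start h) (feed h n (Box \<alpha> (Bot h)))) s \<longleftrightarrow>
      (s = fst M h \<longrightarrow> (\<nexists>\<sigma>. ((\<lambda>i. 0)(0 := n), \<sigma>) \<in> T))" for M s
  proof -
    have 1: "sat M (Box \<alpha> (Bot h)) s \<longleftrightarrow> (\<nexists>\<sigma>'. (\<sigma>, \<sigma>') \<in> T)" if "represents (fst M h) s \<sigma>" for s \<sigma>
      by (subst sat_Box_realizes[OF assms that, where Q = "\<lambda>_. False"]) auto
    have "represents (fst M h) (fst (fst M h) + 1, snd (fst M h)) (\<lambda>i. 0)"
      unfolding represents_def by (intro exI[of _ 1]) simp
    from sat_feed[where Q = "\<lambda>\<sigma>. \<nexists>\<sigma>'. (\<sigma>, \<sigma>') \<in> T", OF 1 this, of n]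
    show ?thesis by (cases s; cases "fst M h") (auto simp: start_def relcomp_unfold)
  qed
  then show ?thesis
    unfolding valid_def by (metis fst_conv)
qed

section \<open>Computing the codes of formulas\<close>

definition recf_const :: "nat \<Rightarrow> recf" where
  "recf_const c = ((\<lambda>f. Comp Succ [f]) ^^ c) Zero"

definition recf_add :: recf where
  "recf_add = PrimRec (Proj 0) (Comp Succ [Proj 1])"

definition recf_triangle :: recf where
  "recf_triangle = PrimRec Zero (Comp Succ [Comp recf_add [Proj 0, Proj 1]])"

text \<open>Cantor's pairing: \<open>prod_encode (m, n)\<close> is
  \<open>triangle (m + n) + m\<close>.\<close>

definition recf_prod_encode :: "recf \<Rightarrow> recf \<Rightarrow> recf" where
  "recf_prod_encode f g =
    Comp recf_add [Comp recf_triangle [Comp recf_add [f, g]], f]"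

text \<open>4 is the tag of \<open>Box\<close> in \<open>fm_code\<close>, and \<open>c\<close> is
  meant to be the code of the increment program. In the recursion step \<open>Proj 1\<close> is the
  code obtained so far.\<close>

definition recf_feed :: "nat \<Rightarrow> recf" where
  "recf_feed c = PrimRec (Proj 0)
    (recf_prod_encode (recf_const 4) (recf_prod_encode (recf_const c) (Proj 1)))"

text \<open>The list \<open>[Proj 0, Proj 0]\<close> is the diagonal: one number is used both as the
  input to be fed and as the code of the formula.\<close>

definition recf_diag :: "nat \<Rightarrow> nat \<Rightarrow> recf" where
  "recf_diag s c = recf_prod_encode (recf_const 4)
    (recf_prod_encode (recf_const s) (Comp (recf_feed c) [Proj 0, Proj 0]))"

lemma eval_Comp1: "eval g xs y \<Longrightarrow> eval f [y] z \<Longrightarrow> eval (Comp f [g]) xs z"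
  by (rule eval_Comp[where ys = "[y]"]) auto

lemma eval_Comp2:
  "eval g xs y \<Longrightarrow> eval g' xs y' \<Longrightarrow> eval f [y, y'] z \<Longrightarrow> eval (Comp f [g, g']) xs z"
  by (rule eval_Comp[where ys = "[y, y']"]) auto

lemma eval_Proj': "i < length xs \<Longrightarrow> y = xs ! i \<Longrightarrow> eval (Proj i) xs y"
  using eval_Proj by simp

lemma eval_const: "eval (recf_const c) xs c"
  unfolding recf_const_def
  by (induction c) (auto intro: eval_Comp1 eval.intros)

lemma eval_add: "eval recf_add [m, n] (m + n)"
  unfolding recf_add_def
proof (induction m)
  case 0
  show ?case by (rule eval_PrimRec_0) (simp add: eval_Proj')
next
  case (Suc m)
  then show ?case
    by (rule eval_PrimRec_Suc) (auto intro!: eval_Comp1 eval_Proj' eval_Succ)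
qed

lemma eval_triangle: "eval recf_triangle [n] (triangle n)"
  unfolding recf_triangle_def
proof (induction n)
  case 0
  show ?case by (auto intro: eval.intros)
next
  case (Suc n)
  have "eval (Comp Succ [Comp recf_add [Proj 0, Proj 1]]) [n, triangle n] (Suc (n + triangle n))"
    by (rule eval_Comp1[OF eval_Comp2 eval_Succ]) (auto intro: eval_Proj' eval_add)
  with Suc show ?case by (auto intro: eval_PrimRec_Suc simp: add.commute)
qed

lemma eval_prod_encode:
  "eval f xs m \<Longrightarrow> eval g xs n \<Longrightarrow> eval (recf_prod_encode f g) xs (prod_encode (m, n))"
  unfolding recf_prod_encode_def prod_encode_def split
  by (intro eval_Comp2 eval_Comp1) (assumption | rule eval_add eval_triangle)+

lemma eval_feed:
  "eval (recf_feed (prog_code a g (transfer h 1 (pr 0)))) [n, fm_code a g \<chi>]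
    (fm_code a g (feed h n \<chi>))"
  unfolding recf_feed_def
proof (induction n)
  case 0
  show ?case by (rule eval_PrimRec_0) (simp add: eval_Proj')
next
  case (Suc n)
  then show ?case
    by (rule eval_PrimRec_Suc)
      (auto intro!: eval_prod_encode eval_const eval_Proj')
qed

lemma eval_diag:
  "eval (recf_diag (prog_code a g (start h)) (prog_code a g (transfer h 1 (pr 0)))) [fm_code a g \<chi>]
    (fm_code a g (Box (start h) (feed h (fm_code a g \<chi>) \<chi>)))"
  unfolding recf_diag_def fm_code.simps
  by (intro eval_prod_encode eval_const eval_Comp2[OF _ _ eval_feed]) (simp_all add: eval_Proj')

theorem corollary1:
  fixes atm_index :: "'p \<Rightarrow> nat" and agt_index :: "'i::finite \<Rightarrow> nat"
  assumes "bij atm_index"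
    and "bij_betw agt_index UNIV {1..CARD('i)}"
  shows "\<not> computably_enumerable (fm_code atm_index agt_index ` {\<phi> :: ('p, 'i) fm. valid \<phi>})"
proof
  let ?code = "fm_code atm_index agt_index :: ('p, 'i) fm \<Rightarrow> nat"
  let ?pcode = "prog_code atm_index agt_index :: ('p, 'i) prog \<Rightarrow> nat"
  have inj: "inj ?code"
    using assms by (intro inj_fm_code) (auto simp: bij_def bij_betw_def)
  assume "computably_enumerable (?code ` {\<phi>. valid \<phi>})"
  then obtain f where "?code ` {\<phi>. valid \<phi>} = {x. \<exists>y. eval f [x] y}"
    unfolding computably_enumerable_def by blast
  then have f: "valid \<phi> \<longleftrightarrow> (\<exists>y. eval f [?code \<phi>] y)" for \<phi>
    using inj_image_mem_iff[OF inj, of \<phi> "{\<phi>. valid \<phi>}"] by simp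
  \<comment> \<open>One agent suffices as the origin, and every type is inhabited.\<close>
  obtain h :: 'i where True by simp
  define d where "d = recf_diag (?pcode (start h)) (?pcode (transfer h 1 (pr 0)))"
  \<comment> \<open>The input is in register 0 and the output in register 1, with scratch space from
    2 on.\<close>
  obtain T where T: "realizable TYPE('p) h T" "computes T 2 (Comp f [d]) [0] 1"
    by (rule compilableD[OF compilable, of "[0]" 2 1]) auto
  then obtain \<alpha> :: "('p, 'i) prog" where \<alpha>: "realizes h \<alpha> T"
    unfolding realizable_def by blast
  define \<chi> where "\<chi> = Box \<alpha> (Bot h)"
  define m where "m = ?code \<chi>"
  let ?\<psi> = "Box (start h) (feed h m \<chi>)"
  have d: "eval d [m] (?code ?\<psi>)"
    unfolding d_def m_def by (rule eval_diag)
  have "(\<lambda>i. 0)(0 := m) \<in> clean 2" by (simp add: clean_def)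
  from computesD[OF T(2) this]
  have "(\<exists>\<sigma>. ((\<lambda>i. 0)(0 := m), \<sigma>) \<in> T) \<longleftrightarrow> (\<exists>y. eval (Comp f [d]) [m] y)"
    by auto
  \<comment> \<open>\<open>d\<close> is defined at \<open>m\<close> with a unique value, so the
    composition is defined there iff \<open>f\<close> is defined at that value.\<close>
  also have "\<dots> \<longleftrightarrow> (\<exists>y. eval f [?code ?\<psi>] y)"
  proof
    assume "\<exists>y. eval (Comp f [d]) [m] y"
    then obtain y x where "eval d [m] x" "eval f [x] y"
      by (auto elim!: eval_CompE simp: list_all2_Cons1)
    then show "\<exists>y. eval f [?code ?\<psi>] y" using eval_unique[OF d] by blast
  next
    assume "\<exists>y. eval f [?code ?\<psi>] y"
    then show "\<exists>y. eval (Comp f [d]) [m] y" using d by (blast intro: eval_Comp1)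
  qed
  \<comment> \<open>By \<open>valid_feed\<close> the formula is valid iff \<open>T\<close> has no
    run from \<open>m\<close>, hence iff \<open>f\<close> is undefined at its code, whereas
    \<open>f\<close> is defined exactly at the codes of valid formulas.\<close>
  finally show False
    using valid_feed[OF \<alpha>, of m] f[of ?\<psi>] unfolding \<chi>_def by blast
qed

end
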